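(* Let $\alpha$ be a nonzero complex number, $\lambda$ a complex number, and $n\ge 0$, $k\ge 1$ integers. Then $$y_{1,\alpha}^{*}(n,k;\lambda)=\frac{1}{k!}\sum_{j=0}^{k}\alpha^{k-j}\binom{k}{j}\frac{j}{k}B_{k-j}^{(k)}\sum_{\ell=0}^{j}\binom{j}{\ell}\lambda^{\ell}\ell^{n}.$$
   Context: For an element $x$ of a commutative $\mathbb{C}$-algebra (e.g. a number or a formal power series in $t$), the degenerate falling factorial is $(x)_{0,\alpha}=1$ and $(x)_{n,\alpha}=x(x-\alpha)(x-2\alpha)\cdots(x-(n-1)\alpha)$ for $n\ge 1$. The new type degenerate Simsek numbers $y_{1,\alpha}^{*}(n,k;\lambda)$ are defined by the generating function $$\frac{(\lambda e^t+1)_{k,\alpha}}{k!}=\sum_{n=0}^{\infty}y_{1,\alpha}^{*}(n,k;\lambda)\frac{t^n}{n!}.$$ The Bernoulli numbers $B_n^{(k)}$ of order $k$ are defined by $$\left(\frac{t}{e^t-1}\right)^k=\sum_{n=0}^{\infty}B_n^{(k)}\frac{t^n}{n!}.$$ Convention: $0^0=1$. *)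

theory Defs
  imports Complex_Main "HOL-Computational_Algebra.Formal_Power_Series"
begin

text \<open>
  The scalar is passed as its image in the algebra: \<open>\<alpha>\<close> itself for complex numbers,
  \<open>fps_const \<alpha>\<close> for formal power series.
\<close>

definition degenerate_ff :: "'a::comm_ring_1 \<Rightarrow> nat \<Rightarrow> 'a \<Rightarrow> 'a" where
  "degenerate_ff x n a = (\<Prod>i<n. x - of_nat i * a)"

definition simsek_gf :: "complex \<Rightarrow> nat \<Rightarrow> complex \<Rightarrow> complex fps" where
  "simsek_gf \<alpha> k lam =
     fps_const (1 / fact k) *
     degenerate_ff (fps_const lam * fps_exp 1 + 1) k (fps_const \<alpha>)"

definition degenerate_simsek :: "complex \<Rightarrow> nat \<Rightarrow> nat \<Rightarrow> complex \<Rightarrow> complex" where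
  "degenerate_simsek \<alpha> n k lam = fact n * fps_nth (simsek_gf \<alpha> k lam) n"

definition bernoulli_order_gf :: "nat \<Rightarrow> complex fps" where
  "bernoulli_order_gf k = (fps_X / (fps_exp 1 - 1)) ^ k"

text \<open>\<open>bernoulli_order k n\<close> is the \<open>n\<close>-th Bernoulli number of order \<open>k\<close>.\<close>

definition bernoulli_order :: "nat \<Rightarrow> nat \<Rightarrow> complex" where
  "bernoulli_order k n = fact n * fps_nth (bernoulli_order_gf k) n"

lemma simsek_gf_expansion:
  "simsek_gf \<alpha> k lam = Abs_fps (\<lambda>n. degenerate_simsek \<alpha> n k lam / fact n)"
  by (simp add: fps_eq_iff degenerate_simsek_def)

lemma bernoulli_order_gf_expansion:
  "bernoulli_order_gf k = Abs_fps (\<lambda>n. bernoulli_order k n / fact n)"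
  by (simp add: fps_eq_iff bernoulli_order_def)

text \<open>
  Division of power series is only a true quotient when the divisor divides; here it does,
  although \<open>fps_exp 1 - 1\<close> is not a unit.
\<close>

lemma fps_X_div_exp_minus_one:
  "(fps_X / (fps_exp 1 - 1)) * (fps_exp 1 - 1) = (fps_X :: complex fps)"
proof -
  have c: "fps_nth (fps_exp 1 - 1 :: complex fps) 1 \<noteq> 0"
    by simp
  then have nz: "fps_exp 1 - 1 \<noteq> (0 :: complex fps)"
    by (metis fps_zero_nth)
  have "subdegree (fps_exp 1 - 1 :: complex fps) \<le> 1"
    using c by (rule subdegree_leI)
  then have "(fps_exp 1 - 1 :: complex fps) dvd fps_X"
    using nz by (simp add: fps_dvd_iff)
  then show ?thesis
    by simp
qed

end

theory Submission
  imports Defs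
begin

unbundle fps_syntax

text \<open>
  The series \<open>F = t / (e\<^sup>t - 1)\<close> satisfies \<open>t F' = F - t F - F\<^sup>2\<close>. Hence the coefficients of
  \<open>F\<^sup>k\<close> and \<open>F\<^sup>k\<^sup>+\<^sup>1\<close> are related by a recurrence which, after rescaling, is the one
  for the coefficients of \<open>x (x - 1) \<dots> (x - k)\<close>. Substituting \<open>x = \<lambda> e\<^sup>t + 1\<close>
  and expanding its powers binomially gives the formula.
\<close>

text \<open>Differentiate \<open>F * E = fps_X\<close> for \<open>E = fps_exp 1 - 1\<close>,
  multiply by \<open>fps_X\<close> and cancel the nonzero factor \<open>E\<close>.\<close>

lemma fps_deriv_X_div_exp_minus_one:
  defines "F \<equiv> fps_X / (fps_exp 1 - 1) :: complex fps"
  shows "fps_X * fps_deriv F = F - fps_X * F - F\<^sup>2"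
proof -
  define E :: "complex fps" where "E = fps_exp 1 - 1"
  have FE: "F * E = fps_X"
    unfolding F_def E_def by (rule fps_X_div_exp_minus_one)
  then have nz: "E \<noteq> 0"
    by auto
  have dE: "fps_deriv E = E + 1"
    by (simp add: E_def)
  have "fps_deriv (F * E) = 1"
    by (simp only: FE fps_deriv_fps_X)
  then have d: "fps_deriv F * E = 1 - F * (E + 1)"
    by (simp add: dE algebra_simps)
  have "(fps_X * fps_deriv F) * E = fps_X * (1 - F * (E + 1))"
    by (simp add: mult.assoc d)
  also have "\<dots> = (F - fps_X * F - F\<^sup>2) * E"
    unfolding FE [symmetric] by (simp add: algebra_simps power2_eq_square)
  finally show ?thesis
    using nz by simp
qed

lemma bernoulli_order_gf_deriv:
  "fps_X * fps_deriv (bernoulli_order_gf k) =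
     of_nat k * (bernoulli_order_gf k - fps_X * bernoulli_order_gf k - bernoulli_order_gf (Suc k))"
proof (cases k)
  case 0
  then show ?thesis
    by (simp add: bernoulli_order_gf_def)
next
  case (Suc l)
  define F :: "complex fps" where "F = fps_X / (fps_exp 1 - 1)"
  have "fps_X * fps_deriv (F ^ k) = of_nat k * F ^ l * (fps_X * fps_deriv F)"
    by (simp add: fps_deriv_power Suc fps_of_nat mult_ac del: power_Suc of_nat_Suc)
  also have "\<dots> = of_nat k * F ^ l * (F - fps_X * F - F\<^sup>2)"
    unfolding F_def by (simp only: fps_deriv_X_div_exp_minus_one)
  finally show ?thesis
    by (simp add: bernoulli_order_gf_def F_def [symmetric] Suc algebra_simps power2_eq_square)
qed

text \<open>Comparing coefficients of t^(m+1) turns the differential equation into a recurrence in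
  order and index.\<close>

lemma bernoulli_order_gf_nth_rec:
  "of_nat k * bernoulli_order_gf (Suc k) $ Suc m =
     (of_nat k - of_nat (Suc m)) * bernoulli_order_gf k $ Suc m
       - of_nat k * bernoulli_order_gf k $ m"
proof -
  have "(fps_X * fps_deriv (bernoulli_order_gf k)) $ Suc m =
    (fps_const (of_nat k) *
      (bernoulli_order_gf k - fps_X * bernoulli_order_gf k - bernoulli_order_gf (Suc k))) $ Suc m"
    by (simp only: bernoulli_order_gf_deriv fps_of_nat)
  then show ?thesis
    by (simp add: algebra_simps)
qed

text \<open>Since e^t - 1 starts with t, the linear coefficient of F (e^t - 1) = t is the constant
  term of F.\<close>

lemma bernoulli_order_gf_nth_0 [simp]: "bernoulli_order_gf k $ 0 = 1"
proof -
  define F :: "complex fps" where "F = fps_X / (fps_exp 1 - 1)"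
  have "(F * (fps_exp 1 - 1)) $ 1 = 1"
    unfolding F_def by (simp only: fps_X_div_exp_minus_one) simp
  then have "F $ 0 = 1"
    by (simp add: fps_mult_nth)
  then show ?thesis
    by (simp add: bernoulli_order_gf_def F_def [symmetric] fps_nth_power_0)
qed

text \<open>The coefficient of \<open>x\<^sup>j\<^sup>+\<^sup>1\<close> in \<open>x (x - 1) \<dots> (x - k)\<close>.\<close>

definition falling_coeff :: "nat \<Rightarrow> nat \<Rightarrow> complex" where
  "falling_coeff k j =
     (if j \<le> k then fact k / fact j * bernoulli_order_gf (Suc k) $ (k - j) else 0)"

text \<open>With order and index both k + 1, the first term on the right of the recurrence
  vanishes.\<close>

lemma falling_coeff_Suc_0: "falling_coeff (Suc k) 0 = - of_nat (Suc k) * falling_coeff k 0"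
  using arg_cong [OF bernoulli_order_gf_nth_rec [of "Suc k" k], of "\<lambda>x. fact k * x"]
  by (simp add: falling_coeff_def algebra_simps)

text \<open>The rule of the signed Stirling numbers of the first kind, as produced by the new factor
  x - (k + 1). For j < k it is the coefficient recurrence rescaled by k!/(j+1)!.\<close>

lemma falling_coeff_Suc_Suc:
  "falling_coeff (Suc k) (Suc j) = falling_coeff k j - of_nat (Suc k) * falling_coeff k (Suc j)"
proof (cases "j < k")
  case True
  then obtain m where k: "k = Suc (j + m)"
    by (metis less_imp_Suc_add)
  let ?b = "bernoulli_order_gf (Suc k)" and ?c = "bernoulli_order_gf (Suc (Suc k))"
  have fj: "(fact (Suc j) :: complex) = of_nat (Suc j) * fact j" "(of_nat (Suc j) :: complex) \<noteq> 0"
    "(fact j :: complex) \<noteq> 0"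
    by (simp_all only: fact_Suc of_nat_neq_0 fact_nonzero not_False_eq_True)
  \<comment> \<open>Here (k + 1) - (m + 1) = j + 1, which then cancels against (j + 1)!.\<close>
  have "of_nat (Suc k) * ?c $ Suc m = of_nat (Suc j) * ?b $ Suc m - of_nat (Suc k) * ?b $ m"
    using bernoulli_order_gf_nth_rec [of "Suc k" m] by (simp add: k)
  then have "fact k / fact (Suc j) * (of_nat (Suc k) * ?c $ Suc m) =
      fact k / fact (Suc j) * (of_nat (Suc j) * ?b $ Suc m - of_nat (Suc k) * ?b $ m)"
    by (simp only:)
  also have "\<dots> = fact k / fact j * ?b $ Suc m - of_nat (Suc k) * (fact k / fact (Suc j) * ?b $ m)"
    unfolding fj(1) using fj(2,3) by (simp add: field_simps del: of_nat_Suc)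
  finally have "fact (Suc k) / fact (Suc j) * ?c $ Suc m =
      fact k / fact j * ?b $ Suc m - of_nat (Suc k) * (fact k / fact (Suc j) * ?b $ m)"
    by (simp add: mult_ac)
  moreover have "Suc k - Suc j = Suc m" "k - j = Suc m" "k - Suc j = m"
    by (simp_all add: k)
  ultimately show ?thesis
    using True by (simp only: falling_coeff_def Suc_le_eq) simp
next
  case False
  then show ?thesis
    \<comment> \<open>At j = k both leading coefficients are 1 and the third is the default 0; for j
      > k all three are 0.\<close>
    by (cases "j = k") (simp_all add: falling_coeff_def del: fact_Suc)
qed

text \<open>By homogeneity, each factor x given up in the product contributes one \<alpha>. The
  induction multiplies by x - (k + 1) \<alpha>.\<close>

lemma degenerate_ff_Suc_expand:
  "degenerate_ff x (Suc k) (fps_const \<alpha>) =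
     (\<Sum>j\<le>k. fps_const (\<alpha> ^ (k - j) * falling_coeff k j) * x ^ Suc j)"
proof (induction k)
  case 0
  show ?case
    by (simp add: degenerate_ff_def falling_coeff_def)
next
  case (Suc k)
  define a where "a j = fps_const (\<alpha> ^ (k - j) * falling_coeff k j)" for j
  let ?r = "fps_const (of_nat (Suc k) * \<alpha>)"
  \<comment> \<open>The case j = k is separate because \<open>k - Suc j\<close> truncates there;
    \<open>a (Suc k)\<close> is 0.\<close>
  have a_Suc: "fps_const (\<alpha> ^ (k - j) * falling_coeff (Suc k) (Suc j)) = a j - ?r * a (Suc j)"
    if "j \<le> k" for j
  proof (cases "j = k")
    case True
    then show ?thesis
      by (simp add: a_def falling_coeff_def del: fact_Suc)
  next
    case False
    then have "\<alpha> ^ (k - j) = \<alpha> * \<alpha> ^ (k - Suc j)"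
      using that by (metis Suc_diff_Suc le_neq_implies_less power_Suc)
    then show ?thesis
      by (simp add: a_def falling_coeff_Suc_Suc algebra_simps)
  qed
  have a_0: "fps_const (\<alpha> ^ Suc k * falling_coeff (Suc k) 0) = - (?r * a 0)"
    by (simp add: a_def falling_coeff_Suc_0 algebra_simps)
  have a_top: "a (Suc k) = 0"
    by (simp add: a_def falling_coeff_def)
  \<comment> \<open>As \<open>a (Suc k)\<close> vanishes, the shifted sum may keep the upper bound k
    and combine with the unshifted one.\<close>
  have shift: "(\<Sum>j\<le>k. a j * x ^ Suc j) = a 0 * x + (\<Sum>j\<le>k. a (Suc j) * x ^ Suc (Suc j))"
    using sum.atMost_Suc_shift [of "\<lambda>j. a j * x ^ Suc j" k] by (simp add: a_top)
  have "degenerate_ff x (Suc (Suc k)) (fps_const \<alpha>) = (\<Sum>j\<le>k. a j * x ^ Suc j) * (x - ?r)"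
  proof -
    have "degenerate_ff x (Suc (Suc k)) (fps_const \<alpha>) =
        degenerate_ff x (Suc k) (fps_const \<alpha>) * (x - of_nat (Suc k) * fps_const \<alpha>)"
      by (simp add: degenerate_ff_def)
    also have "of_nat (Suc k) * fps_const \<alpha> = ?r"
      by (simp only: fps_of_nat [symmetric] fps_const_mult)
    finally show ?thesis
      by (simp only: Suc.IH a_def)
  qed
  also have "\<dots> = (\<Sum>j\<le>k. a j * x ^ Suc (Suc j)) - ?r * (\<Sum>j\<le>k. a j * x ^ Suc j)"
    by (simp add: right_diff_distrib sum_subtractf sum_distrib_left sum_distrib_right mult_ac)
  also have "\<dots> = - (?r * a 0) * x + (\<Sum>j\<le>k. (a j - ?r * a (Suc j)) * x ^ Suc (Suc j))"
    unfolding shift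
    by (simp add: left_diff_distrib right_diff_distrib sum_subtractf sum_distrib_left distrib_left
        mult_ac del: fps_const_mult of_nat_Suc)
  also have "\<dots> = (\<Sum>j\<le>Suc k. fps_const (\<alpha> ^ (Suc k - j) * falling_coeff (Suc k) j) * x ^ Suc j)"
    by (subst sum.atMost_Suc_shift) (simp add: a_Suc a_0 del: fps_const_mult of_nat_Suc power_Suc)
  finally show ?case .
qed

text \<open>Binomial theorem, with l^n / n! as the coefficient of t^n in e^(l t).\<close>

lemma fps_nth_exp_plus_1_power:
  "((fps_const lam * fps_exp 1 + 1) ^ j :: complex fps) $ n =
     (\<Sum>l=0..j. of_nat (j choose l) * lam ^ l * of_nat l ^ n) / fact n"
proof -
  have "(of_nat (j choose l) * (fps_const lam * fps_exp 1) ^ l * 1 ^ (j - l)) $ n =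
      of_nat (j choose l) * lam ^ l * of_nat l ^ n / fact n" for l
    by (simp add: power_mult_distrib fps_exp_power_mult fps_of_nat [symmetric] mult.assoc
        fps_const_power)
  then show ?thesis
    by (simp only: binomial_ring fps_sum_nth sum_divide_distrib atMost_atLeast0)
qed

text \<open>Absorption reduces the binomial factors to (k choose j), and (k choose j) (k - j)! =
  k!/j!.\<close>

lemma falling_coeff_eq_bernoulli_order:
  assumes "j \<le> k"
  shows "falling_coeff k j =
    of_nat (Suc k choose Suc j) * (of_nat (Suc j) / of_nat (Suc k)) * bernoulli_order (Suc k) (k - j)"
proof -
  have "(of_nat (Suc k) * of_nat (k choose j) :: complex)
      = of_nat (Suc k choose Suc j) * of_nat (Suc j)"
    by (simp only: of_nat_mult [symmetric] Suc_times_binomial_eq)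
  then have "of_nat (Suc k choose Suc j) * (of_nat (Suc j) / of_nat (Suc k)) =
      (of_nat (k choose j) :: complex)"
    by (simp add: field_simps del: of_nat_Suc binomial_Suc_Suc)
  moreover have "(of_nat (k choose j) :: complex) * fact (k - j) = fact k / fact j"
    using assms by (simp add: binomial_fact)
  ultimately show ?thesis
    using assms by (simp only: falling_coeff_def bernoulli_order_def mult.assoc [symmetric] if_True)
qed

theorem proposition2p4:
  fixes \<alpha> lam :: complex and n k :: nat
  assumes "\<alpha> \<noteq> 0" and "k \<ge> 1"
  shows "degenerate_simsek \<alpha> n k lam =
    1 / fact k *
      (\<Sum>j=0..k. \<alpha> ^ (k - j) * of_nat (k choose j) * (of_nat j / of_nat k) *
         bernoulli_order k (k - j) *
         (\<Sum>l=0..j. of_nat (j choose l) * lam ^ l * of_nat l ^ n))"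
proof -
  obtain m where k: "k = Suc m"
    using assms(2) by (cases k) auto
  define S :: "nat \<Rightarrow> complex"
    where "S j = (\<Sum>l=0..j. of_nat (j choose l) * lam ^ l * of_nat l ^ n)" for j
  let ?x = "fps_const lam * fps_exp 1 + 1"
  have "degenerate_simsek \<alpha> n k lam =
      1 / fact k * (\<Sum>j\<le>m. \<alpha> ^ (m - j) * falling_coeff m j * (fact n * (?x ^ Suc j) $ n))"
    unfolding degenerate_simsek_def simsek_gf_def k degenerate_ff_Suc_expand
    by (simp add: fps_sum_nth sum_distrib_left mult_ac del: fact_Suc power_Suc)
  also have "\<dots> = 1 / fact k * (\<Sum>j\<le>m. \<alpha> ^ (m - j) * falling_coeff m j * S (Suc j))"
    unfolding fps_nth_exp_plus_1_power S_def by simp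
  also have "\<dots> = 1 / fact k * (\<Sum>j\<le>k. \<alpha> ^ (k - j) * of_nat (k choose j) *
      (of_nat j / of_nat k) * bernoulli_order k (k - j) * S j)"
    \<comment> \<open>The sum over j from 0 to k loses its term j = 0 through the factor j/k; the
      rest is the sum over m, shifted by one.\<close>
    unfolding k sum.atMost_Suc_shift
    by (simp add: falling_coeff_eq_bernoulli_order mult.assoc
        del: fact_Suc of_nat_Suc binomial_Suc_Suc)
  finally show ?thesis
    by (simp only: S_def atMost_atLeast0)
qed

end
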